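(* For $x>0$, let $W_{\alpha(x)}$ be the unilateral weighted shift on $\ell^2(\mathbb{Z}_+)$ with weight sequence given by $\alpha_0:=\sqrt{x}$ and $\alpha_n:=\sqrt{\frac{n+2}{n+3}}$ for $n\ge1$. Then: (i) If $\frac{200}{297}<x\le\frac{667}{990}$, then $W_{\alpha(x)}$ is quartically hyponormal but not $3$-hyponormal. (ii) If $W_{\alpha(x)}$ is $3$-hyponormal, then it is also quartically hyponormal.
   Context: $\ell^2(\mathbb{Z}_+)$ is the complex Hilbert space of square-summable sequences with canonical orthonormal basis $\{e_n\}_{n=0}^\infty$. Given a bounded sequence of positive numbers $\alpha:\alpha_0,\alpha_1,\ldots$ (weights), the (unilateral) weighted shift $W_\alpha$ is the bounded operator on $\ell^2(\mathbb{Z}_+)$ with $W_\alpha e_n=\alpha_ne_{n+1}$ for all $n\ge0$. For bounded operators, $[A,B]:=AB-BA$. A bounded operator $T$ on a complex Hilbert space $\mathcal H$ is $k$-hyponormal if the $k\times k$ operator matrix $([T^{*j},T^i])_{i,j=1}^k$ is positive (semidefinite) on the direct sum of $k$ copies of $\mathcal H$. $T$ is hyponormal if $T^*T\ge TT^*$. $T$ is weakly $k$-hyponormal if $\sum_{j=1}^k\lambda_jT^j$ is hyponormal for all $\lambda_1,\ldots,\lambda_k\in\mathbb{C}$; quartically hyponormal means weakly $4$-hyponormal. *)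

theory Defs
  imports "HOL-Analysis.Analysis" "HOL-Library.Nonpos_Ints"
begin

section \<open>The complex Hilbert space of square-summable sequences\<close>

typedef ell2 = "{x :: nat \<Rightarrow> complex. summable (\<lambda>n. (cmod (x n))\<^sup>2)}"
  morphisms coord Abs_ell2
  by (rule exI[of _ "\<lambda>_. 0"]) simp

setup_lifting type_definition_ell2

lemma summable_coord: "summable (\<lambda>n. (cmod (coord x n))\<^sup>2)"
  using coord[of x] by simp

lemma ell2_eqI: "(\<And>n. coord x n = coord y n) \<Longrightarrow> x = y"
  by (metis coord_inject ext)

lemma cmod_add_sq_le: "(cmod (a + b))\<^sup>2 \<le> 2 * (cmod a)\<^sup>2 + 2 * (cmod b)\<^sup>2"
proof -
  have "(cmod (a + b))\<^sup>2 \<le> (cmod a + cmod b)\<^sup>2"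
    by (simp add: norm_triangle_ineq power_mono)
  also have "\<dots> \<le> 2 * (cmod a)\<^sup>2 + 2 * (cmod b)\<^sup>2"
    using zero_le_power2[of "cmod a - cmod b"] by (simp add: power2_eq_square algebra_simps)
  finally show ?thesis .
qed

lemma square_summable_add:
  assumes "summable (\<lambda>n. (cmod (f n))\<^sup>2)" "summable (\<lambda>n. (cmod (g n))\<^sup>2)"
  shows "summable (\<lambda>n. (cmod (f n + g n))\<^sup>2)"
proof (rule summable_comparison_test')
  show "summable (\<lambda>n. 2 * (cmod (f n))\<^sup>2 + 2 * (cmod (g n))\<^sup>2)"
    by (intro summable_add summable_mult assms)
qed (use cmod_add_sq_le in auto)

instantiation ell2 :: ab_group_add
begin
lift_definition zero_ell2 :: ell2 is "\<lambda>_. 0" by simp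
lift_definition plus_ell2 :: "ell2 \<Rightarrow> ell2 \<Rightarrow> ell2" is "\<lambda>x y n. x n + y n"
  by (rule square_summable_add)
lift_definition uminus_ell2 :: "ell2 \<Rightarrow> ell2" is "\<lambda>x n. - x n" by simp
lift_definition minus_ell2 :: "ell2 \<Rightarrow> ell2 \<Rightarrow> ell2" is "\<lambda>x y n. x n - y n"
  subgoal for x y using square_summable_add[of x "\<lambda>n. - y n"] by simp
  done
instance by standard (transfer; simp add: algebra_simps)+
end

lift_definition scaleC :: "complex \<Rightarrow> ell2 \<Rightarrow> ell2" (infixr \<open>*\<^sub>C\<close> 75) is "\<lambda>c x n. c * x n"
  by (simp add: norm_mult power_mult_distrib summable_mult)

instantiation ell2 :: real_vector
begin
definition scaleR_ell2 :: "real \<Rightarrow> ell2 \<Rightarrow> ell2" where "scaleR r x = complex_of_real r *\<^sub>C x"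
instance by standard (unfold scaleR_ell2_def, (transfer; simp add: algebra_simps)+)
end

lemma coord_simps [simp]:
  "coord 0 n = 0" "coord (x + y) n = coord x n + coord y n" "coord (- x) n = - coord x n"
  "coord (x - y) n = coord x n - coord y n" "coord (c *\<^sub>C x) n = c * coord x n"
  "coord (r *\<^sub>R x) n = of_real r * coord x n"
  by (simp_all add: zero_ell2.rep_eq plus_ell2.rep_eq uminus_ell2.rep_eq minus_ell2.rep_eq
      scaleC.rep_eq scaleR_ell2_def)

lemma coord_sum [simp]: "coord (sum f A) n = (\<Sum>a\<in>A. coord (f a) n)"
  by (induction A rule: infinite_finite_induct) simp_all

definition cinner :: "ell2 \<Rightarrow> ell2 \<Rightarrow> complex" where
  "cinner x y = (\<Sum>n. coord x n * cnj (coord y n))"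

lemma summable_cinner: "summable (\<lambda>n. coord x n * cnj (coord y n))"
proof (rule summable_comparison_test')
  show "summable (\<lambda>n. (cmod (coord x n))\<^sup>2 + (cmod (coord y n))\<^sup>2)"
    by (intro summable_add summable_coord)
  show "norm (coord x n * cnj (coord y n)) \<le> (cmod (coord x n))\<^sup>2 + (cmod (coord y n))\<^sup>2" for n
    using sum_squares_bound[of "cmod (coord x n)" "cmod (coord y n)"]
      mult_nonneg_nonneg[of "cmod (coord x n)" "cmod (coord y n)"]
    by (simp add: norm_mult del: mult_nonneg_nonneg)
qed

lemma cinner_add_left: "cinner (x + y) z = cinner x z + cinner y z"
  unfolding cinner_def by (simp add: suminf_add summable_cinner algebra_simps)

lemma cinner_add_right: "cinner z (x + y) = cinner z x + cinner z y"
  unfolding cinner_def by (simp add: suminf_add summable_cinner algebra_simps)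

lemma cinner_scaleC_left: "cinner (c *\<^sub>C x) y = c * cinner x y"
  unfolding cinner_def by (simp add: suminf_mult summable_cinner mult.assoc)

lemma cinner_scaleC_right: "cinner x (c *\<^sub>C y) = cnj c * cinner x y"
proof -
  have "(\<Sum>n. coord x n * cnj (coord (c *\<^sub>C y) n)) = (\<Sum>n. cnj c * (coord x n * cnj (coord y n)))"
    by (simp add: algebra_simps)
  then show ?thesis unfolding cinner_def by (simp add: suminf_mult summable_cinner)
qed

lemma cinner_commute: "cinner y x = cnj (cinner x y)"
proof -
  have "(\<lambda>n. cnj (coord x n * cnj (coord y n))) sums cnj (cinner x y)"
    unfolding sums_cnj cinner_def by (rule summable_sums[OF summable_cinner])
  then show ?thesis unfolding cinner_def by (simp add: sums_iff mult.commute)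
qed

lemma cinner_self: "cinner x x = of_real (\<Sum>n. (cmod (coord x n))\<^sup>2)"
  unfolding cinner_def
  by (simp add: complex_norm_square[symmetric] suminf_of_real[OF summable_coord] del: of_real_power)

instantiation ell2 :: real_inner
begin
definition inner_ell2 :: "ell2 \<Rightarrow> ell2 \<Rightarrow> real" where "inner x y = Re (cinner x y)"
definition norm_ell2 :: "ell2 \<Rightarrow> real" where "norm x = sqrt (Re (cinner x x))"
definition sgn_ell2 :: "ell2 \<Rightarrow> ell2" where "sgn (x :: ell2) = inverse (norm x) *\<^sub>R x"
definition dist_ell2 :: "ell2 \<Rightarrow> ell2 \<Rightarrow> real" where "dist (x :: ell2) y = norm (x - y)"
definition uniformity_ell2 :: "(ell2 \<times> ell2) filter" where
  "uniformity = (INF e\<in>{0<..}. principal {(x :: ell2, y). dist x y < e})"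
definition open_ell2 :: "ell2 set \<Rightarrow> bool" where
  "open (U :: ell2 set) \<longleftrightarrow> (\<forall>x\<in>U. eventually (\<lambda>(x', y). x' = x \<longrightarrow> y \<in> U) uniformity)"
instance
proof
  fix x y z :: ell2 and r :: real
  show "inner x y = inner y x"
    unfolding inner_ell2_def by (subst cinner_commute) simp
  show "inner (x + y) z = inner x z + inner y z"
    by (simp add: inner_ell2_def cinner_add_left)
  show "inner (r *\<^sub>R x) y = r * inner x y"
    by (simp add: inner_ell2_def scaleR_ell2_def cinner_scaleC_left)
  show "0 \<le> inner x x"
    by (simp add: inner_ell2_def cinner_self suminf_nonneg summable_coord)
  show "inner x x = 0 \<longleftrightarrow> x = 0"
    by (auto simp: inner_ell2_def cinner_self suminf_eq_zero_iff summable_coord intro: ell2_eqI)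
qed (simp_all add: sgn_ell2_def dist_ell2_def uniformity_ell2_def open_ell2_def norm_ell2_def
    inner_ell2_def)
end

lift_definition basis :: "nat \<Rightarrow> ell2" is "\<lambda>m n. if n = m then 1 else 0"
  by (rule summable_finite[of "{m}" for m]) auto

section \<open>Bounded operators\<close>

definition bounded_clinear :: "(ell2 \<Rightarrow> ell2) \<Rightarrow> bool" where
  "bounded_clinear T \<longleftrightarrow> bounded_linear T \<and> (\<forall>c x. T (c *\<^sub>C x) = c *\<^sub>C T x)"

definition cadjoint :: "(ell2 \<Rightarrow> ell2) \<Rightarrow> (ell2 \<Rightarrow> ell2)" where
  "cadjoint T = (THE S. bounded_clinear S \<and> (\<forall>x y. cinner (T x) y = cinner x (S y)))"

definition commutator :: "(ell2 \<Rightarrow> ell2) \<Rightarrow> (ell2 \<Rightarrow> ell2) \<Rightarrow> (ell2 \<Rightarrow> ell2)" where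
  "commutator A B = (\<lambda>x. A (B x) - B (A x))"

definition positive_op :: "(ell2 \<Rightarrow> ell2) \<Rightarrow> bool" where
  "positive_op A \<longleftrightarrow> (\<forall>x. cinner (A x) x \<in> \<real>\<^sub>\<ge>\<^sub>0)"

text \<open>A vector of the direct sum of \<open>k\<close> copies of the space is given by the values of
  \<open>x\<close> at \<open>1, \<dots>, k\<close>; all other values of \<open>x\<close> are irrelevant.\<close>

definition positive_op_matrix :: "nat \<Rightarrow> (nat \<Rightarrow> nat \<Rightarrow> ell2 \<Rightarrow> ell2) \<Rightarrow> bool" where
  "positive_op_matrix k A \<longleftrightarrow>
     (\<forall>x :: nat \<Rightarrow> ell2. (\<Sum>i=1..k. cinner (\<Sum>j=1..k. A i j (x j)) (x i)) \<in> \<real>\<^sub>\<ge>\<^sub>0)"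

definition k_hyponormal :: "nat \<Rightarrow> (ell2 \<Rightarrow> ell2) \<Rightarrow> bool" where
  "k_hyponormal k T \<longleftrightarrow>
     positive_op_matrix k (\<lambda>i j. commutator (cadjoint T ^^ j) (T ^^ i))"

definition hyponormal :: "(ell2 \<Rightarrow> ell2) \<Rightarrow> bool" where
  "hyponormal T \<longleftrightarrow> positive_op (\<lambda>x. cadjoint T (T x) - T (cadjoint T x))"

definition weakly_k_hyponormal :: "nat \<Rightarrow> (ell2 \<Rightarrow> ell2) \<Rightarrow> bool" where
  "weakly_k_hyponormal k T \<longleftrightarrow>
     (\<forall>l :: nat \<Rightarrow> complex. hyponormal (\<lambda>x. \<Sum>j=1..k. l j *\<^sub>C (T ^^ j) x))"

abbreviation quartically_hyponormal :: "(ell2 \<Rightarrow> ell2) \<Rightarrow> bool" where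
  "quartically_hyponormal \<equiv> weakly_k_hyponormal 4"

definition weighted_shift :: "(nat \<Rightarrow> real) \<Rightarrow> (ell2 \<Rightarrow> ell2)" where
  "weighted_shift \<alpha> =
     (THE W. bounded_clinear W \<and> (\<forall>n. W (basis n) = of_real (\<alpha> n) *\<^sub>C basis (Suc n)))"

section \<open>The adjoint and the weighted shift are well defined\<close>

lemma norm_sq: "(norm (x :: ell2))\<^sup>2 = (\<Sum>n. (cmod (coord x n))\<^sup>2)"
  by (simp add: norm_ell2_def cinner_self suminf_nonneg summable_coord)

lemma coord_basis: "coord (basis m) n = (if n = m then 1 else 0)"
  by (simp add: basis.rep_eq)

lemma norm_scaleC: "norm (c *\<^sub>C x) = cmod c * norm x"
proof -
  have "(norm (c *\<^sub>C x))\<^sup>2 = (cmod c * norm x)\<^sup>2"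
    by (simp add: norm_sq norm_mult power_mult_distrib suminf_mult summable_coord)
  then show ?thesis by simp
qed

lemma cinner_norm_le: "cmod (cinner x y) \<le> norm x * norm y"
proof -
  define u where "u = cnj (sgn (cinner x y))"
  have "u * cinner x y = of_real (cmod (cinner x y))"
  proof (cases "cinner x y = 0")
    case False
    have u: "u = cnj (cinner x y) / of_real (cmod (cinner x y))"
      by (simp add: u_def sgn_eq)
    show ?thesis
      unfolding u using False complex_norm_square[of "cinner x y"]
      by (simp add: field_simps power2_eq_square)
  qed (simp add: u_def)
  then have "cmod (cinner x y) = inner (u *\<^sub>C x) y"
    by (simp add: inner_ell2_def cinner_scaleC_left)
  also have "\<dots> \<le> norm (u *\<^sub>C x) * norm y" by (rule norm_cauchy_schwarz)
  also have "\<dots> \<le> norm x * norm y"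
    by (intro mult_right_mono) (auto simp: norm_scaleC u_def norm_sgn)
  finally show ?thesis .
qed

lemma bounded_linear_cinner_left: "bounded_linear (\<lambda>x. cinner x y)"
  by (rule bounded_linear_intro[where K = "norm y"])
    (simp_all add: cinner_add_left scaleR_ell2_def cinner_scaleC_left scaleR_conv_of_real
      cinner_norm_le)

lemma cinner_sum_left: "cinner (\<Sum>a\<in>A. f a) y = (\<Sum>a\<in>A. cinner (f a) y)"
  by (rule linear_sum[OF bounded_linear.linear[OF bounded_linear_cinner_left]])

lemma cinner_basis_right: "cinner x (basis n) = coord x n"
proof -
  have "(\<lambda>m. coord x m * cnj (coord (basis n) m)) sums (\<Sum>m\<in>{n}. coord x m * cnj (coord (basis n) m))"
    by (rule sums_finite) (auto simp: coord_basis)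
  then show ?thesis unfolding cinner_def by (simp add: sums_iff coord_basis)
qed

lemma cinner_eqI: "(\<And>x. cinner x y = cinner x z) \<Longrightarrow> y = z"
  by (metis cinner_basis_right cinner_commute ell2_eqI)

lemma truncation_tendsto: "(\<lambda>N. \<Sum>n<N. coord x n *\<^sub>C basis n) \<longlonglongrightarrow> x"
proof -
  let ?t = "\<lambda>N. \<Sum>n<N. coord x n *\<^sub>C basis n"
  let ?f = "\<lambda>n. (cmod (coord x n))\<^sup>2"
  have c: "coord (?t N) m = (if m < N then coord x m else 0)" for N m
    by (simp add: coord_basis if_distrib cong: if_cong)
  have "(norm (x - ?t N))\<^sup>2 = (\<Sum>n. ?f n) - (\<Sum>n<N. ?f n)" for N
  proof -
    have "(norm (x - ?t N))\<^sup>2 = (\<Sum>n. (cmod (coord (x - ?t N) n))\<^sup>2)" by (rule norm_sq)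
    also have "(\<lambda>n. (cmod (coord (x - ?t N) n))\<^sup>2) = (\<lambda>n. ?f n - (if n \<in> {..<N} then ?f n else 0))"
      by (auto simp: c simp del: coord_sum)
    also have "(\<Sum>n. ?f n - (if n \<in> {..<N} then ?f n else 0))
        = (\<Sum>n. ?f n) - (\<Sum>n. if n \<in> {..<N} then ?f n else 0)"
      by (rule suminf_diff[symmetric])
        (use summable_coord sums_summable[OF sums_If_finite_set] in auto)
    also have "(\<Sum>n. if n \<in> {..<N} then ?f n else 0) = (\<Sum>n<N. ?f n)"
      by (rule sums_unique[symmetric], rule sums_If_finite_set) simp
    finally show ?thesis .
  qed
  moreover have "(\<lambda>N. (\<Sum>n. ?f n) - (\<Sum>n<N. ?f n)) \<longlonglongrightarrow> (\<Sum>n. ?f n) - (\<Sum>n. ?f n)"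
    by (intro tendsto_intros summable_LIMSEQ summable_coord)
  ultimately have "(\<lambda>N. (norm (x - ?t N))\<^sup>2) \<longlonglongrightarrow> 0" by simp
  then have "(\<lambda>N. sqrt ((norm (x - ?t N))\<^sup>2)) \<longlonglongrightarrow> sqrt 0" by (rule tendsto_real_sqrt)
  then have "(\<lambda>N. norm (?t N - x)) \<longlonglongrightarrow> 0" by (simp add: norm_minus_commute)
  then show ?thesis by (simp add: LIM_zero_cancel tendsto_norm_zero_iff)
qed

lemma bounded_clinear_sum:
  assumes "bounded_clinear T"
  shows "T (\<Sum>a\<in>A. c a *\<^sub>C f a) = (\<Sum>a\<in>A. c a *\<^sub>C T (f a))"
  using assms linear_sum[of T "\<lambda>a. c a *\<^sub>C f a" A]
  by (simp add: bounded_clinear_def bounded_linear.linear)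

lemma bounded_clinear_eqI:
  assumes S: "bounded_clinear S" and T: "bounded_clinear T"
    and eq: "\<And>n. S (basis n) = T (basis n)"
  shows "S = T"
proof
  fix x
  let ?t = "\<lambda>N. \<Sum>n<N. coord x n *\<^sub>C basis n"
  have bl: "bounded_linear S" "bounded_linear T"
    using S T by (simp_all add: bounded_clinear_def)
  have "(\<lambda>N. S (?t N)) \<longlonglongrightarrow> S x" "(\<lambda>N. T (?t N)) \<longlonglongrightarrow> T x"
    using bounded_linear.tendsto[OF bl(1) truncation_tendsto]
      bounded_linear.tendsto[OF bl(2) truncation_tendsto] by auto
  moreover have "S (?t N) = T (?t N)" for N
    by (simp add: bounded_clinear_sum[OF S] bounded_clinear_sum[OF T] eq)
  ultimately show "S x = T x"
    by (auto intro: LIMSEQ_unique)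
qed

lemma bounded_clinearI:
  assumes "\<And>x y. T (x + y) = T x + T y" "\<And>c x. T (c *\<^sub>C x) = c *\<^sub>C T x"
    "\<And>x. norm (T x) \<le> norm x * K"
  shows "bounded_clinear T"
  unfolding bounded_clinear_def
  using assms by (auto simp: scaleR_ell2_def intro!: bounded_linear_intro[where K = K])

theorem cadjoint_ex1:
  assumes T: "bounded_clinear T"
  shows "\<exists>!S. bounded_clinear S \<and> (\<forall>x y. cinner (T x) y = cinner x (S y))"
proof -
  have bl: "bounded_linear T" using T by (simp add: bounded_clinear_def)
  obtain K where K: "\<And>x. norm (T x) \<le> norm x * K" and K0: "K > 0"
    using bounded_linear.pos_bounded[OF bl] by blast
  define z where "z y n = cinner y (T (basis n))" for y n
  have part: "(\<Sum>n<N. (cmod (z y n))\<^sup>2) \<le> (K * norm y)\<^sup>2" for y N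
  proof -
    define x where "x = (\<Sum>n<N. z y n *\<^sub>C basis n)"
    define s where "s = (\<Sum>n<N. (cmod (z y n))\<^sup>2)"
    have s0: "s \<ge> 0" by (simp add: s_def sum_nonneg)
    have "coord x n = (if n \<in> {..<N} then z y n else 0)" for n
      by (simp add: x_def coord_basis if_distrib cong: if_cong)
    then have "(\<lambda>n. (cmod (coord x n))\<^sup>2) = (\<lambda>n. if n \<in> {..<N} then (cmod (z y n))\<^sup>2 else 0)"
      by auto
    moreover have "(\<lambda>n. if n \<in> {..<N} then (cmod (z y n))\<^sup>2 else 0) sums s"
      unfolding s_def by (rule sums_If_finite_set) simp
    ultimately have nx: "(norm x)\<^sup>2 = s" by (simp add: norm_sq sums_iff)
    have "cinner (T x) y = (\<Sum>n<N. z y n * cnj (z y n))"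
      unfolding x_def bounded_clinear_sum[OF T] cinner_sum_left cinner_scaleC_left z_def
      by (simp add: cinner_commute[of _ y])
    also have "\<dots> = of_real s"
      by (simp add: s_def complex_norm_square[symmetric] del: of_real_power)
    finally have "s = cmod (cinner (T x) y)" using s0 by simp
    also have "\<dots> \<le> norm (T x) * norm y" by (rule cinner_norm_le)
    also have "\<dots> \<le> norm x * (K * norm y)"
      using mult_right_mono[OF K[of x] norm_ge_zero[of y]] by (simp add: mult.assoc)
    finally have le: "norm x * norm x \<le> norm x * (K * norm y)"
      using nx by (simp add: power2_eq_square)
    have "norm x \<le> K * norm y"
    proof (cases "x = 0")
      case False
      then show ?thesis using le by simp
    qed (use K0 in simp)
    then have "(norm x)\<^sup>2 \<le> (K * norm y)\<^sup>2" by (simp add: power_mono)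
    then show ?thesis using nx s_def by simp
  qed
  have sz: "summable (\<lambda>n. (cmod (z y n))\<^sup>2)" for y
    using part by (intro summableI_nonneg_bounded) auto
  define S where "S y = Abs_ell2 (z y)" for y
  have cS: "coord (S y) = z y" for y
    using sz by (simp add: S_def Abs_ell2_inverse)
  have "norm (S y) \<le> norm y * K" for y
  proof -
    have "(norm (S y))\<^sup>2 \<le> (K * norm y)\<^sup>2"
      unfolding norm_sq cS using part by (intro suminf_le_const sz) auto
    then have "norm (S y) \<le> K * norm y"
      by (rule power2_le_imp_le) (use K0 in simp)
    then show ?thesis by (simp add: mult.commute)
  qed
  then have bS: "bounded_clinear S"
    by (intro bounded_clinearI[where K = K] ell2_eqI)
      (simp_all add: cS z_def cinner_add_left cinner_scaleC_left)
  have adj: "cinner (T x) y = cinner x (S y)" for x y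
  proof -
    let ?t = "\<lambda>N. \<Sum>n<N. coord x n *\<^sub>C basis n"
    have "(\<lambda>N. cinner (T (?t N)) y) \<longlonglongrightarrow> cinner (T x) y"
      by (intro bounded_linear.tendsto[OF bounded_linear_cinner_left] bounded_linear.tendsto[OF bl]
          truncation_tendsto)
    moreover have "(\<lambda>N. cinner (?t N) (S y)) \<longlonglongrightarrow> cinner x (S y)"
      by (intro bounded_linear.tendsto[OF bounded_linear_cinner_left] truncation_tendsto)
    moreover have "cinner (T (?t N)) y = cinner (?t N) (S y)" for N
    proof -
      have "cinner (T (basis n)) y = cinner (basis n) (S y)" for n
        by (metis cS cinner_basis_right cinner_commute z_def)
      then show ?thesis
        by (simp add: bounded_clinear_sum[OF T] cinner_sum_left cinner_scaleC_left)
    qed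
    ultimately show ?thesis by (auto intro: LIMSEQ_unique)
  qed
  show ?thesis
  proof (rule ex1I[of _ S])
    show "bounded_clinear S \<and> (\<forall>x y. cinner (T x) y = cinner x (S y))"
      using bS adj by blast
    show "S' = S" if "bounded_clinear S' \<and> (\<forall>x y. cinner (T x) y = cinner x (S' y))" for S'
      using that adj by (intro ext cinner_eqI) metis
  qed
qed

lemma cadjoint:
  assumes "bounded_clinear T"
  shows bounded_clinear_cadjoint: "bounded_clinear (cadjoint T)"
    and cinner_cadjoint: "cinner (T x) y = cinner x (cadjoint T y)"
  using theI'[OF cadjoint_ex1[OF assms]] unfolding cadjoint_def by blast+

theorem weighted_shift_ex1:
  assumes bdd: "bounded (range \<alpha>)"
  shows "\<exists>!W. bounded_clinear W \<and> (\<forall>n. W (basis n) = of_real (\<alpha> n) *\<^sub>C basis (Suc n))"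
proof -
  obtain K where K: "\<And>n. \<bar>\<alpha> n\<bar> \<le> K"
    using bdd by (auto simp: bounded_iff)
  have K0: "K \<ge> 0" using K[of 0] by linarith
  define w where "w x n = (case n of 0 \<Rightarrow> 0 | Suc m \<Rightarrow> of_real (\<alpha> m) * coord x m)" for x n
  have le: "(cmod (w x (Suc n)))\<^sup>2 \<le> K\<^sup>2 * (cmod (coord x n))\<^sup>2" for x n
    using power_mono[OF K[of n], of 2]
    by (simp add: w_def norm_mult power_mult_distrib mult_right_mono)
  have sS: "summable (\<lambda>n. (cmod (w x (Suc n)))\<^sup>2)" for x
    by (rule summable_comparison_test'[OF summable_mult[OF summable_coord]]) (use le in auto)
  then have sw: "summable (\<lambda>n. (cmod (w x n))\<^sup>2)" for x
    by (subst (asm) summable_Suc_iff)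
  define W where "W x = Abs_ell2 (w x)" for x
  have cW: "coord (W x) = w x" for x
    using sw by (simp add: W_def Abs_ell2_inverse)
  have "norm (W x) \<le> norm x * K" for x
  proof -
    have "(norm (W x))\<^sup>2 = (\<Sum>n. (cmod (w x (Suc n)))\<^sup>2)"
      unfolding norm_sq cW using suminf_split_head[OF sw] by (simp add: w_def)
    also have "\<dots> \<le> (\<Sum>n. K\<^sup>2 * (cmod (coord x n))\<^sup>2)"
      by (intro suminf_le le sS summable_mult summable_coord)
    also have "\<dots> = (norm x * K)\<^sup>2"
      by (simp add: norm_sq suminf_mult summable_coord power_mult_distrib mult.commute)
    finally show ?thesis by (rule power2_le_imp_le) (use K0 in simp)
  qed
  then have "bounded_clinear W"
    by (intro bounded_clinearI[where K = K] ell2_eqI)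
      (simp_all add: cW w_def algebra_simps split: nat.split)
  moreover have "W (basis n) = of_real (\<alpha> n) *\<^sub>C basis (Suc n)" for n
    by (rule ell2_eqI) (simp add: cW w_def coord_basis split: nat.split)
  ultimately show ?thesis
    by (intro ex1I[of _ W]) (auto intro: bounded_clinear_eqI)
qed

lemma weighted_shift:
  assumes "bounded (range \<alpha>)"
  shows bounded_clinear_weighted_shift: "bounded_clinear (weighted_shift \<alpha>)"
    and weighted_shift_basis: "weighted_shift \<alpha> (basis n) = of_real (\<alpha> n) *\<^sub>C basis (Suc n)"
  using theI'[OF weighted_shift_ex1[OF assms]] unfolding weighted_shift_def by blast+

section \<open>The weight sequence\<close>

definition weights :: "real \<Rightarrow> nat \<Rightarrow> real" where
  "weights x n = (if n = 0 then sqrt x else sqrt ((real n + 2) / (real n + 3)))"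

lemma weights_pos: "x > 0 \<Longrightarrow> weights x n > 0"
  by (simp add: weights_def)

lemma bounded_weights: "bounded (range (weights x))"
proof -
  have "\<bar>weights x n\<bar> \<le> max 1 \<bar>sqrt x\<bar>" for n
    by (auto simp: weights_def le_max_iff_disj)
  then show ?thesis by (auto simp: bounded_iff)
qed

end

(* In the power-series model of the shift, W is multiplication by z and the squared norm of z^n is
   3x/(n+2) for n > 0 and 1 for n = 0: for x = 2/3 this is a subnormal shift, and x perturbs only
   the norm of the constants.  For p = c_1 z + ... + c_4 z^4 the form |p f|^2 - |p(W)* f|^2 splits
   into the diagonals n - j = m of the products conj(c_j) f_n.  Each diagonal m <> 0 is a Gram form
   of Cauchy type, hence nonnegative; diagonal 0 involves conj(c_j) f_j, and when x > 200/297 it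
   fails to be nonnegative for independent entries (even without j = 4), which is the failure of
   3-hyponormality.  But it is bounded below by a multiple of Re(conj(c_1) f_1 c_2 conj(f_2)), and
   this is compensated by the entries conj(c_2) f_1 of diagonal -1 and conj(c_1) f_2 of diagonal 1,
   whose product has the same modulus. *)
theory Submission
  imports Defs
begin

section \<open>Cauchy matrices and three numerical forms\<close>

text \<open>1 / (u_i + u_j) is the integral of exp ((u_i + u_j) t) over t <= 0, so the form is the
  integral of a square. Instead of integrating, the proof uses the antiderivative \<open>g\<close>
  of that square: it is nondecreasing up to 0 and tends to 0 at minus infinity, so
  \<open>g 0\<close> is nonnegative.\<close>

lemma cauchy_form_nonneg:
  fixes u c :: "'a \<Rightarrow> real"
  assumes "finite S" and u: "\<And>i. i \<in> S \<Longrightarrow> 0 < u i"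
  shows "0 \<le> (\<Sum>i\<in>S. \<Sum>j\<in>S. c i * c j / (u i + u j))"
proof -
  define g where "g t = (\<Sum>i\<in>S. \<Sum>j\<in>S. c i * c j / (u i + u j) * exp ((u i + u j) * t))" for t
  have "(g has_real_derivative (\<Sum>i\<in>S. c i * exp (u i * t))\<^sup>2) (at t)" for t
  proof -
    have "(g has_real_derivative
        (\<Sum>i\<in>S. \<Sum>j\<in>S. c i * c j / (u i + u j) * (exp ((u i + u j) * t) * (u i + u j)))) (at t)"
      unfolding g_def by (intro DERIV_sum DERIV_cmult) (auto intro!: derivative_eq_intros)
    also have "(\<Sum>i\<in>S. \<Sum>j\<in>S. c i * c j / (u i + u j) * (exp ((u i + u j) * t) * (u i + u j)))
        = (\<Sum>i\<in>S. \<Sum>j\<in>S. (c i * exp (u i * t)) * (c j * exp (u j * t)))"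
    proof (intro sum.cong refl)
      fix i j assume "i \<in> S" "j \<in> S"
      then have "u i + u j \<noteq> 0" using u[of i] u[of j] by linarith
      then show "c i * c j / (u i + u j) * (exp ((u i + u j) * t) * (u i + u j))
          = (c i * exp (u i * t)) * (c j * exp (u j * t))"
        by (simp add: exp_add distrib_right)
    qed
    also have "\<dots> = (\<Sum>i\<in>S. c i * exp (u i * t))\<^sup>2"
      by (simp add: power2_eq_square sum_product)
    finally show ?thesis .
  qed
  then have "g t \<le> g 0" if "t \<le> 0" for t
    using that by (intro DERIV_nonneg_imp_nondecreasing[of t 0 g]) (meson zero_le_power2)+
  moreover have "(g \<longlongrightarrow> (\<Sum>i\<in>S. \<Sum>j\<in>S. c i * c j / (u i + u j) * 0)) at_bot"
    unfolding g_def
  proof (intro tendsto_intros)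
    fix i j assume "i \<in> S" "j \<in> S"
    then have "0 < u i + u j" using u[of i] u[of j] by linarith
    then show "((\<lambda>t. exp ((u i + u j) * t)) \<longlongrightarrow> 0) at_bot"
      by (intro filterlim_compose[OF exp_at_bot]
          filterlim_tendsto_pos_mult_at_bot[OF tendsto_const _ filterlim_ident])
  qed
  ultimately have "0 \<le> g 0"
    by (intro tendsto_upperbound[of g 0 at_bot])
      (auto simp: eventually_at_bot_linorder intro!: exI[of _ 0])
  then show ?thesis by (simp add: g_def)
qed

lemma cmod_sum_sq: "(cmod (\<Sum>i\<in>S. d i))\<^sup>2 = (\<Sum>i\<in>S. \<Sum>j\<in>S. Re (d i * cnj (d j)))"
proof -
  have "complex_of_real ((cmod (\<Sum>i\<in>S. d i))\<^sup>2) = (\<Sum>i\<in>S. \<Sum>j\<in>S. d i * cnj (d j))"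
    unfolding complex_norm_square by (simp add: sum_product)
  then have "Re (complex_of_real ((cmod (\<Sum>i\<in>S. d i))\<^sup>2)) = Re (\<Sum>i\<in>S. \<Sum>j\<in>S. d i * cnj (d j))"
    by (rule arg_cong)
  then show ?thesis by (simp only: Re_complex_of_real Re_sum)
qed

lemma cauchy_hermitian_form_nonneg:
  fixes u :: "'a \<Rightarrow> real" and b :: "'a \<Rightarrow> complex"
  assumes "finite S" "\<And>i. i \<in> S \<Longrightarrow> 0 < u i"
  shows "0 \<le> (\<Sum>i\<in>S. \<Sum>j\<in>S. Re (b i * cnj (b j)) / (u i + u j))"
  using cauchy_form_nonneg[OF assms, where c = "\<lambda>i. Re (b i)"]
    cauchy_form_nonneg[OF assms, where c = "\<lambda>i. Im (b i)"]
  by (simp add: add_divide_distrib sum.distrib)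

text \<open>Positivity of the diagonals \<open>-1\<close>, \<open>1\<close> and \<open>0\<close>. The constants \<open>35280\<close> and \<open>250880\<close> are
  optimal, being diagonal entries of the inverse matrices, and \<open>94080\<close> is their geometric mean;
  the squares come from Cholesky decomposition.\<close>

lemma subdiagonal_form_bound:
  fixes a b c d :: real
  shows "b\<^sup>2 / 35280 \<le> a\<^sup>2/3 + b\<^sup>2/5 + c\<^sup>2/7 + d\<^sup>2/9
     + 2 * (a*b/4 + a*c/5 + a*d/6 + b*c/6 + b*d/7 + c*d/8)"
proof -
  have "a\<^sup>2/3 + b\<^sup>2/5 + c\<^sup>2/7 + d\<^sup>2/9
     + 2 * (a*b/4 + a*c/5 + a*d/6 + b*c/6 + b*d/7 + c*d/8) - b\<^sup>2 / 35280
    = (3/2*a + 9/7*b + 9/8*c + d)\<^sup>2/9 + (28/5*a + 8/3*b + c)\<^sup>2/448 + (a + 5/28*b)\<^sup>2/75"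
    by (simp add: field_simps power2_eq_square)
  moreover have "0 \<le> \<dots>" by simp
  ultimately show ?thesis by linarith
qed

lemma superdiagonal_form_bound:
  fixes a b c d :: real
  shows "a\<^sup>2 / 250880 \<le> a\<^sup>2/5 + b\<^sup>2/7 + c\<^sup>2/9 + d\<^sup>2/11
     + 2 * (a*b/6 + a*c/7 + a*d/8 + b*c/8 + b*d/9 + c*d/10) - 3 * (a/4 + b/5 + c/6 + d/7)\<^sup>2"
proof -
  have "a\<^sup>2/5 + b\<^sup>2/7 + c\<^sup>2/9 + d\<^sup>2/11
     + 2 * (a*b/6 + a*c/7 + a*d/8 + b*c/8 + b*d/9 + c*d/10) - 3 * (a/4 + b/5 + c/6 + d/7)\<^sup>2
         - a\<^sup>2 / 250880
    = (77/128*a + 77/90*b + 77/80*c + d)\<^sup>2*(16/539) + (135/56*a + 2*b + c)\<^sup>2/3600 +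
      (45/16*a + b)\<^sup>2/56700"
    by (simp add: field_simps power2_eq_square)
  moreover have "0 \<le> \<dots>" by simp
  ultimately show ?thesis by linarith
qed

lemma main_diagonal_form_bound:
  fixes a b c d t :: real
  assumes "t \<le> 667/330"
  shows "a*b*(2/94080) \<le> a\<^sup>2/4 + b\<^sup>2/6 + c\<^sup>2/8 + d\<^sup>2/10
     + 2 * (a*b/5 + a*c/6 + a*d/7 + b*c/7 + b*d/8 + c*d/9) - t * (a/3 + b/4 + c/5 + d/6)\<^sup>2"
proof -
  \<comment> \<open>The form is nonincreasing in \<open>t\<close>, so it suffices to treat the end
    point 667/330, which is three times 667/990.\<close>
  have "a\<^sup>2/4 + b\<^sup>2/6 + c\<^sup>2/8 + d\<^sup>2/10
     + 2 * (a*b/5 + a*c/6 + a*d/7 + b*c/7 + b*d/8 + c*d/9) - 667/330 * (a/3 + b/4 + c/5 + d/6)\<^sup>2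
         - a*b*(2/94080)
    = (2542/3647*a + 969/1042*b + 2598/2605*c + d)\<^sup>2*(521/11880) +
      (47060/17451*a + 12290/5817*b + c)\<^sup>2*(277/521000) +
      (4679/1968*a + b)\<^sup>2*(41/977256) + a\<^sup>2*(1265/111089664)"
    by (simp add: field_simps power2_eq_square)
  moreover have "0 \<le> \<dots>" by simp
  moreover have "t * (a/3 + b/4 + c/5 + d/6)\<^sup>2 \<le> 667/330 * (a/3 + b/4 + c/5 + d/6)\<^sup>2"
    by (rule mult_right_mono[OF assms]) simp
  ultimately show ?thesis by linarith
qed

section \<open>Self-commutators of polynomials in a weighted shift\<close>

lemma cadjoint_eqI:
  assumes "bounded_clinear T" "\<And>x y. cinner (T x) y = cinner x (S y)"
  shows "cadjoint T = S"
  using assms cinner_cadjoint[OF assms(1)] by (intro ext cinner_eqI) metis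

lemma cinner_self_norm: "cinner x x = of_real ((norm x)\<^sup>2)"
  by (simp add: cinner_self norm_sq del: of_real_power)

lemma hyponormal_iff:
  assumes "bounded_clinear T"
  shows "hyponormal T \<longleftrightarrow> (\<forall>x. (norm (cadjoint T x))\<^sup>2 \<le> (norm (T x))\<^sup>2)"
proof -
  have "cinner (cadjoint T (T x) - T (cadjoint T x)) x
      = of_real ((norm (T x))\<^sup>2 - (norm (cadjoint T x))\<^sup>2)" for x
  proof -
    have "cinner (cadjoint T (T x) - T (cadjoint T x)) x
        = cinner (cadjoint T (T x)) x - cinner (T (cadjoint T x)) x"
      using cinner_add_left[of "cadjoint T (T x) - T (cadjoint T x)" "T (cadjoint T x)" x]
      by (simp add: algebra_simps)
    also have "cinner (cadjoint T (T x)) x = cinner (T x) (T x)"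
      by (metis assms cinner_cadjoint cinner_commute)
    also have "cinner (T (cadjoint T x)) x = cinner (cadjoint T x) (cadjoint T x)"
      by (simp add: assms cinner_cadjoint)
    finally show ?thesis by (simp add: cinner_self_norm)
  qed
  then show ?thesis
    unfolding hyponormal_def positive_op_def
    by (simp add: nonneg_Reals_of_real_iff del: of_real_diff of_real_power)
qed

lemma bounded_clinear_funpow:
  assumes "bounded_clinear T"
  shows "bounded_clinear (T ^^ k)"
proof (induction k)
  case 0
  show ?case by (simp add: bounded_clinear_def id_def bounded_linear_ident)
next
  case (Suc k)
  then show ?case
    using assms by (auto simp: bounded_clinear_def o_def intro: bounded_linear_compose)
qed

lemma scaleC_sum_right: "c *\<^sub>C (\<Sum>a\<in>A. f a) = (\<Sum>a\<in>A. c *\<^sub>C f a)"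
  by (rule ell2_eqI) (simp add: sum_distrib_left)

lemma scaleC_scaleC: "a *\<^sub>C b *\<^sub>C x = (a * b) *\<^sub>C x"
  by (rule ell2_eqI) simp

lemma bounded_linear_scaleC: "bounded_linear (\<lambda>x. c *\<^sub>C x)"
  by (rule bounded_linear_intro[where K = "cmod c"])
    (auto intro!: ell2_eqI simp: algebra_simps norm_scaleC)

lemma bounded_clinear_combination:
  assumes "\<And>j. bounded_clinear (T j)"
  shows "bounded_clinear (\<lambda>x. \<Sum>j\<in>J. c j *\<^sub>C T j x)"
  using assms unfolding bounded_clinear_def
  by (auto intro!: bounded_linear_sum bounded_linear_compose[OF bounded_linear_scaleC]
      simp: scaleC_sum_right scaleC_scaleC mult.commute)

lemma cinner_sum_right: "cinner y (\<Sum>a\<in>A. f a) = (\<Sum>a\<in>A. cinner y (f a))"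
  by (subst cinner_commute) (simp add: cinner_sum_left cinner_commute[of y])

lemma cinner_funpow_cadjoint:
  assumes "bounded_clinear T"
  shows "cinner ((T ^^ k) x) y = cinner x ((cadjoint T ^^ k) y)"
  by (induction k arbitrary: y)
    (simp_all add: cinner_cadjoint[OF assms] funpow_swap1[of "cadjoint T"])

lemma cinner_funpow_cadjoint_left:
  assumes "bounded_clinear T"
  shows "cinner ((cadjoint T ^^ k) x) y = cinner x ((T ^^ k) y)"
proof -
  have "cinner ((cadjoint T ^^ k) x) y = cnj (cinner y ((cadjoint T ^^ k) x))"
    by (rule cinner_commute)
  also have "\<dots> = cnj (cinner ((T ^^ k) y) x)"
    by (simp add: cinner_funpow_cadjoint[OF assms])
  also have "\<dots> = cinner x ((T ^^ k) y)"
    by (rule cinner_commute[symmetric])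
  finally show ?thesis .
qed

lemma cadjoint_polynomial:
  assumes "bounded_clinear T"
  shows "cadjoint (\<lambda>x. \<Sum>j\<in>J. c j *\<^sub>C (T ^^ j) x) = (\<lambda>y. \<Sum>j\<in>J. cnj (c j) *\<^sub>C (cadjoint T ^^ j) y)"
  by (rule cadjoint_eqI)
    (simp_all add: assms bounded_clinear_combination bounded_clinear_funpow cinner_sum_left
      cinner_sum_right cinner_scaleC_left cinner_scaleC_right cinner_funpow_cadjoint)

section \<open>Powers of a shift with positive weights, and the diagonals of its polynomials\<close>

locale positive_shift =
  fixes \<alpha> :: "nat \<Rightarrow> real"
  assumes bdd: "bounded (range \<alpha>)" and pos: "\<And>n. 0 < \<alpha> n"
begin

abbreviation W where "W \<equiv> weighted_shift \<alpha>"

text \<open>\<open>W ^^ n\<close> maps the basis vector 0 to \<open>w n\<close> times the basis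
  vector n, so \<open>\<gamma> n\<close> is the squared norm of z^n in the power-series
  model.\<close>

definition w :: "nat \<Rightarrow> real" where "w n = (\<Prod>i<n. \<alpha> i)"
definition \<gamma> :: "nat \<Rightarrow> real" where "\<gamma> n = (w n)\<^sup>2"

lemma w_pos [simp]: "0 < w n"
  by (simp add: w_def pos prod_pos)

lemma w_nz [simp]: "w n \<noteq> 0"
  using w_pos[of n] by linarith

lemma w_Suc: "w (Suc n) = w n * \<alpha> n"
  by (simp add: w_def)

lemmas bounded_clinear_W = bounded_clinear_weighted_shift[OF bdd]

text \<open>The values of \<open>W\<close> on basis vectors determine its adjoint coordinatewise;
  \<open>coord_W\<close> then follows by duality, without a limit argument.\<close>

lemma coord_cadjoint_W: "coord (cadjoint W y) n = of_real (\<alpha> n) * coord y (Suc n)"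
proof -
  have "coord (cadjoint W y) n = cnj (cinner (W (basis n)) y)"
    by (metis bounded_clinear_W cinner_basis_right cinner_cadjoint cinner_commute)
  also have "\<dots> = of_real (\<alpha> n) * cnj (cinner (basis (Suc n)) y)"
    by (simp add: weighted_shift_basis[OF bdd] cinner_scaleC_left)
  also have "cnj (cinner (basis (Suc n)) y) = coord y (Suc n)"
    by (metis cinner_basis_right cinner_commute)
  finally show ?thesis .
qed

lemma coord_W: "coord (W x) n = (case n of 0 \<Rightarrow> 0 | Suc m \<Rightarrow> of_real (\<alpha> m) * coord x m)"
proof -
  have "coord (W x) n = cinner x (cadjoint W (basis n))"
    using cinner_cadjoint[OF bounded_clinear_W] by (simp add: cinner_basis_right[symmetric])
  also have "cadjoint W (basis n) = (case n of 0 \<Rightarrow> 0 | Suc m \<Rightarrow> of_real (\<alpha> m) *\<^sub>C basis m)"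
    by (rule ell2_eqI) (auto simp: coord_cadjoint_W coord_basis split: nat.split)
  also have "cinner x \<dots> = (case n of 0 \<Rightarrow> 0 | Suc m \<Rightarrow> of_real (\<alpha> m) * coord x m)"
    by (auto simp: cinner_scaleC_right cinner_basis_right cinner_def[of x 0] split: nat.split)
  finally show ?thesis .
qed

lemma coord_funpow_cadjoint_W:
  "coord ((cadjoint W ^^ k) y) n = of_real (w (n + k) / w n) * coord y (n + k)"
proof (induction k arbitrary: n)
  case (Suc k)
  show ?case using pos[of n] by (simp add: coord_cadjoint_W Suc w_Suc)
qed simp

lemma coord_funpow_W:
  "coord ((W ^^ k) x) n = (if n < k then 0 else of_real (w n / w (n - k)) * coord x (n - k))"
proof (induction k arbitrary: n)
  case (Suc k)
  show ?case by (cases n) (auto simp: coord_W Suc w_Suc)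
qed simp

text \<open>Coordinates of \<open>x\<close> in the power-series model, where \<open>W\<close> is multiplication by the variable;
  they are delayed by \<open>K\<close> places so that all diagonals of a polynomial of degree \<open>K\<close> in
  \<open>W\<close> have a natural number as index.\<close>

definition delayed :: "nat \<Rightarrow> ell2 \<Rightarrow> nat \<Rightarrow> complex" where
  "delayed K x n = (if n < K then 0 else coord x (n - K) / of_real (w (n - K)))"

text \<open>In degree l + i + j - K, the products z^i f and z^j f have the coefficients f_(l+j-K)
  and f_(l+i-K). Numbering the degrees this way makes l the index of a diagonal common to all pairs
  (i, j). Truncated subtraction is harmless because \<open>delayed\<close> vanishes at l + j <
  K.\<close>

lemma sums_cinner_funpow:
  assumes "i \<le> K" "j \<le> K"
  shows "(\<lambda>l. of_real (\<gamma> (l + i + j - K)) * (delayed K x (l + j) * cnj (delayed K x (l + i))))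
           sums cinner ((W ^^ i) x) ((W ^^ j) x)"
proof -
  let ?a = "\<lambda>n. coord ((W ^^ i) x) n * cnj (coord ((W ^^ j) x) n)"
  define a where "a n = (if n < K then 0 else ?a (n - K))" for n
  have "?a sums cinner ((W ^^ i) x) ((W ^^ j) x)"
    unfolding cinner_def by (rule summable_sums[OF summable_cinner])
  then have "(\<lambda>n. a (n + K)) sums cinner ((W ^^ i) x) ((W ^^ j) x)"
    by (simp add: a_def)
  then have "a sums cinner ((W ^^ i) x) ((W ^^ j) x)"
    by (subst (asm) sums_zero_iff_shift) (simp_all add: a_def)
  \<comment> \<open>If n is at least K, then n - K < i + j - K, which is at most i and at most
    j.\<close>
  moreover have "a n = 0" if "n < i + j" for n
    using that assms by (auto simp: a_def coord_funpow_W)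
  ultimately have "(\<lambda>l. a (l + (i + j))) sums cinner ((W ^^ i) x) ((W ^^ j) x)"
    by (subst sums_zero_iff_shift) simp_all
  moreover have "a (l + (i + j)) = of_real (\<gamma> (l + i + j - K)) *
      (delayed K x (l + j) * cnj (delayed K x (l + i)))" for l
  proof -
    have "l + (i + j) - K - i = l + j - K" "l + (i + j) - K - j = l + i - K"
      if "K \<le> l + i" "K \<le> l + j"
      using that by simp_all
    then show ?thesis
      using assms by (auto simp: a_def delayed_def coord_funpow_W
          \<gamma>_def power2_eq_square add.assoc mult_ac)
  qed
  ultimately show ?thesis by simp
qed

lemma coord_polynomial_cadjoint:
  "coord (\<Sum>j=1..K. cnj (c j) *\<^sub>C (cadjoint W ^^ j) x) n
     = (\<Sum>j=1..K. of_real (\<gamma> (n + j)) * (cnj (c j) * delayed K x (n + K + j))) / of_real (w n)"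
  by (auto simp: coord_funpow_cadjoint_W delayed_def \<gamma>_def power2_eq_square sum_divide_distrib
      intro!: sum.cong)

text \<open>The \<open>l\<close>-th diagonal of the self-commutator of a polynomial of degree \<open>K\<close> in \<open>W\<close>
  pairs the coordinates \<open>i + l - K\<close> and \<open>j + l - K\<close> of the power-series model.\<close>

definition diagonal_form :: "nat \<Rightarrow> nat \<Rightarrow> (nat \<Rightarrow> complex) \<Rightarrow> real" where
  "diagonal_form K l b =
     (\<Sum>i=1..K. \<Sum>j=1..K. \<gamma> (l + i + j - K) * Re (b i * cnj (b j))) -
     (if l < K then 0 else (cmod (\<Sum>j=1..K. of_real (\<gamma> (l - K + j)) * b j))\<^sup>2 / \<gamma> (l - K))"

text \<open>Coordinate n of the adjoint image involves only the products conj(c_j) f_(n+j), all on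
  diagonal n + K. Hence both norms split along the same diagonals, and the second contributes one
  square to each l >= K.\<close>

lemma sums_self_commutator_form:
  defines "A \<equiv> \<lambda>c K x. \<Sum>j=1..K. c j *\<^sub>C (W ^^ j) x"
  shows "(\<lambda>l. diagonal_form K l (\<lambda>j. cnj (c j) * delayed K x (l + j)))
           sums ((norm (A c K x))\<^sup>2 - (norm (cadjoint (A c K) x))\<^sup>2)"
proof -
  define b where "b l j = cnj (c j) * delayed K x (l + j)" for l j
  define B where "B = cadjoint (A c K) x"
  have "complex_of_real ((norm (A c K x))\<^sup>2)
      = (\<Sum>i=1..K. \<Sum>j=1..K. c i * (cnj (c j) * cinner ((W ^^ i) x) ((W ^^ j) x)))"
    unfolding cinner_self_norm[symmetric] A_def
    by (simp only: cinner_sum_left cinner_sum_right cinner_scaleC_left cinner_scaleC_right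
        sum_distrib_left)
      (rule trans[OF sum.swap], intro sum.cong refl, simp add: mult_ac)
  moreover have "(\<lambda>l. \<Sum>i=1..K. \<Sum>j=1..K. c i * (cnj (c j) *
      (of_real (\<gamma> (l + i + j - K)) * (delayed K x (l + j) * cnj (delayed K x (l + i))))))
     sums (\<Sum>i=1..K. \<Sum>j=1..K. c i * (cnj (c j) * cinner ((W ^^ i) x) ((W ^^ j) x)))"
    by (intro sums_sum sums_mult sums_cinner_funpow) auto
  ultimately have "(\<lambda>l. \<Sum>i=1..K. \<Sum>j=1..K. c i * (cnj (c j) *
      (of_real (\<gamma> (l + i + j - K)) * (delayed K x (l + j) * cnj (delayed K x (l + i))))))
     sums complex_of_real ((norm (A c K x))\<^sup>2)"
    by simp
  then have "(\<lambda>l. Re (\<Sum>i=1..K. \<Sum>j=1..K. c i * (cnj (c j) *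
      (of_real (\<gamma> (l + i + j - K)) * (delayed K x (l + j) * cnj (delayed K x (l + i)))))))
     sums Re (complex_of_real ((norm (A c K x))\<^sup>2))"
    by (rule sums_Re)
  moreover have "Re (\<Sum>i=1..K. \<Sum>j=1..K. c i * (cnj (c j) *
      (of_real (\<gamma> (l + i + j - K)) * (delayed K x (l + j) * cnj (delayed K x (l + i))))))
      = (\<Sum>i=1..K. \<Sum>j=1..K. \<gamma> (l + i + j - K) * Re (b l i * cnj (b l j)))" for l
    unfolding Re_sum b_def by (intro sum.cong refl) (simp add: algebra_simps)
  ultimately have 1: "(\<lambda>l. \<Sum>i=1..K. \<Sum>j=1..K. \<gamma> (l + i + j - K) * Re (b l i * cnj (b l j)))
      sums (norm (A c K x))\<^sup>2"
    by (simp del: of_real_power)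
  have B: "coord B n = (\<Sum>j=1..K. of_real (\<gamma> (n + j)) * b (n + K) j) / of_real (w n)" for n
    unfolding B_def A_def b_def cadjoint_polynomial[OF bounded_clinear_W]
    by (rule coord_polynomial_cadjoint)
  have "(\<lambda>n. (cmod (coord B n))\<^sup>2) sums (norm B)\<^sup>2"
    unfolding norm_sq by (rule summable_sums[OF summable_coord])
  then have "(\<lambda>n. (cmod (\<Sum>j=1..K. of_real (\<gamma> (n + j)) * b (n + K) j))\<^sup>2 / \<gamma> n) sums (norm B)\<^sup>2"
    by (simp add: B norm_divide power_divide \<gamma>_def)
  then have 2: "(\<lambda>l. if l < K then 0 else (cmod (\<Sum>j=1..K. of_real (\<gamma> (l - K + j)) * b l j))\<^sup>2
      / \<gamma> (l - K)) sums (norm B)\<^sup>2"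
    by (subst sums_zero_iff_shift[of K, symmetric]) simp_all
  show ?thesis
    using sums_diff[OF 1 2] unfolding diagonal_form_def b_def B_def .
qed

lemma weakly_k_hyponormalI:
  assumes "\<And>c x. 0 \<le> (\<Sum>l. diagonal_form K l (\<lambda>j. cnj (c j) * delayed K x (l + j)))"
  shows "weakly_k_hyponormal K W"
  unfolding weakly_k_hyponormal_def
proof
  fix c :: "nat \<Rightarrow> complex"
  have "(norm (cadjoint (\<lambda>x. \<Sum>j=1..K. c j *\<^sub>C (W ^^ j) x) x))\<^sup>2
      \<le> (norm (\<Sum>j=1..K. c j *\<^sub>C (W ^^ j) x))\<^sup>2" for x
    using assms[of c x] sums_unique[OF sums_self_commutator_form[of K c x]] by linarith
  then show "hyponormal (\<lambda>x. \<Sum>j=1..K. c j *\<^sub>C (W ^^ j) x)"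
    by (subst hyponormal_iff) (auto intro!: bounded_clinear_combination bounded_clinear_funpow
        bounded_clinear_W)
qed

section \<open>A necessary condition for k-hyponormality\<close>

lemma cinner_basis: "cinner (basis m) (basis n) = (if m = n then 1 else 0)"
  by (auto simp: cinner_basis_right coord_basis)

text \<open>The operator matrix is tested on a multiple of the j-th basis vector in the j-th copy.
  The j-th adjoint power sends all of these to the line of the basis vector 0, which isolates
  diagonal 0 with independent entries \<open>c j\<close>.\<close>

lemma k_hyponormal_hankel:
  fixes c :: "nat \<Rightarrow> real"
  assumes "k_hyponormal k W"
  shows "(\<Sum>j=1..k. \<gamma> j * c j)\<^sup>2 \<le> (\<Sum>i=1..k. \<Sum>j=1..k. \<gamma> (i + j) * (c i * c j))"
proof -
  define v where "v j = of_real (c j * w j) *\<^sub>C basis j" for j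
  have W: "(W ^^ i) (v j) = of_real (c j * w (i + j)) *\<^sub>C basis (i + j)" for i j
    by (rule ell2_eqI) (auto simp: v_def coord_funpow_W coord_basis add.commute)
  have adj: "(cadjoint W ^^ j) (v j) = of_real (\<gamma> j * c j) *\<^sub>C basis 0" for j
    by (rule ell2_eqI) (auto simp: v_def coord_funpow_cadjoint_W coord_basis w_def
        \<gamma>_def power2_eq_square)
  have "cinner (commutator (cadjoint W ^^ j) (W ^^ i) (v j)) (v i)
     = of_real (\<gamma> (i + j) * (c i * c j) - (\<gamma> i * c i) * (\<gamma> j * c j))" for i j
  proof -
    have "cinner (commutator (cadjoint W ^^ j) (W ^^ i) (v j)) (v i)
      = cinner ((cadjoint W ^^ j) ((W ^^ i) (v j))) (v i)
          - cinner ((W ^^ i) ((cadjoint W ^^ j) (v j))) (v i)"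
      using cinner_add_left[of "commutator (cadjoint W ^^ j) (W ^^ i) (v j)"
          "(W ^^ i) ((cadjoint W ^^ j) (v j))" "v i"]
      by (simp add: commutator_def)
    also have "cinner ((cadjoint W ^^ j) ((W ^^ i) (v j))) (v i)
        = cinner ((W ^^ i) (v j)) ((W ^^ j) (v i))"
      by (rule cinner_funpow_cadjoint_left[OF bounded_clinear_W])
    also have "\<dots> = of_real (\<gamma> (i + j) * (c i * c j))"
      by (simp add: W cinner_scaleC_left cinner_scaleC_right cinner_basis
          \<gamma>_def power2_eq_square add.commute)
    also have "cinner ((W ^^ i) ((cadjoint W ^^ j) (v j))) (v i)
        = cinner ((cadjoint W ^^ j) (v j)) ((cadjoint W ^^ i) (v i))"
      by (rule cinner_funpow_cadjoint[OF bounded_clinear_W])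
    also have "\<dots> = of_real ((\<gamma> i * c i) * (\<gamma> j * c j))"
      by (simp add: adj cinner_scaleC_left cinner_scaleC_right cinner_basis)
    finally show ?thesis by simp
  qed
  then have "(\<Sum>i=1..k. cinner (\<Sum>j=1..k. commutator (cadjoint W ^^ j) (W ^^ i) (v j)) (v i))
     = of_real (\<Sum>i=1..k. \<Sum>j=1..k. \<gamma> (i + j) * (c i * c j) - (\<gamma> i * c i) * (\<gamma> j * c j))"
    by (simp only: cinner_sum_left of_real_sum)
  moreover have "(\<Sum>i=1..k. cinner (\<Sum>j=1..k. commutator (cadjoint W ^^ j) (W ^^ i) (v j)) (v i))
      \<in> \<real>\<^sub>\<ge>\<^sub>0"
    using assms unfolding k_hyponormal_def positive_op_matrix_def by (rule spec)
  ultimately have "0 \<le> (\<Sum>i=1..k. \<Sum>j=1..k. \<gamma> (i + j) * (c i * c j) - (\<gamma> i * c i) * (\<gamma> j * c j))"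
    by (simp only: nonneg_Reals_of_real_iff)
  then show ?thesis
    by (simp only: sum_subtractf power2_eq_square sum_product diff_ge_0_iff_ge)
qed

end

section \<open>The shift with perturbed first weight\<close>

locale perturbed_shift = positive_shift "weights x" for x +
  assumes x_pos: "0 < x"
begin

lemma \<gamma>_0: "\<gamma> 0 = 1"
  by (simp add: \<gamma>_def w_def)

lemma \<gamma>_Suc: "\<gamma> (Suc n) = 3 * x / (real n + 3)"
proof (induction n)
  case 0
  have "(weights x 0)\<^sup>2 = x" using x_pos by (simp add: weights_def)
  then show ?case by (simp add: \<gamma>_def w_def)
next
  case (Suc n)
  have "\<gamma> (Suc (Suc n)) = \<gamma> (Suc n) * (weights x (Suc n))\<^sup>2"
    by (simp add: \<gamma>_def w_Suc power_mult_distrib)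
  also have "(weights x (Suc n))\<^sup>2 = (real n + 3) / (real n + 4)"
    by (simp add: weights_def add_ac)
  finally show ?case unfolding Suc.IH by (simp add: add_ac)
qed

lemma \<gamma>_eq: "0 < n \<Longrightarrow> \<gamma> n = 3 * x / (real n + 2)"
  by (cases n) (simp_all add: \<gamma>_Suc add_ac)

section \<open>Diagonals of Cauchy type\<close>

text \<open>No square is subtracted here. The support of \<open>b\<close> allows only indices i, j
  >= K - l, where l + i + j - K is positive, so \<open>\<gamma> 0\<close> does not occur and the
  matrix is Cauchy with positive nodes \<open>u\<close>.\<close>

lemma diagonal_form_lower:
  assumes l: "l < K" and b: "\<And>j. l + j < K \<Longrightarrow> b j = 0"
  shows "0 \<le> diagonal_form K l b"
proof -
  define u where "u j = real j + (real l - real K + 2) / 2" for j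
  define S where "S = {K - l..K}"
  have u: "0 < u j" if "j \<in> S" for j
  proof -
    have "real K \<le> real j + real l" using that l unfolding S_def by auto
    then show ?thesis using l by (simp add: u_def field_simps)
  qed
  have "diagonal_form K l b = (\<Sum>i=1..K. \<Sum>j=1..K. \<gamma> (l + i + j - K) * Re (b i * cnj (b j)))"
    using l by (simp add: diagonal_form_def)
  also have "\<dots> = (\<Sum>i\<in>S. \<Sum>j=1..K. \<gamma> (l + i + j - K) * Re (b i * cnj (b j)))"
    by (rule sum.mono_neutral_right) (use l b in \<open>auto simp: S_def\<close>)
  also have "\<dots> = (\<Sum>i\<in>S. \<Sum>j\<in>S. \<gamma> (l + i + j - K) * Re (b i * cnj (b j)))"
    by (intro sum.cong refl sum.mono_neutral_right) (use l b in \<open>auto simp: S_def\<close>)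
  also have "\<dots> = (\<Sum>i\<in>S. \<Sum>j\<in>S. 3 * x * (Re (b i * cnj (b j)) / (u i + u j)))"
  proof (intro sum.cong refl)
    fix i j assume ij: "i \<in> S" "j \<in> S"
    then have "0 < l + i + j - K" "K \<le> l + i + j" using l by (auto simp: S_def)
    then have "\<gamma> (l + i + j - K) = 3 * x / (u i + u j)"
      by (simp add: \<gamma>_eq u_def of_nat_diff field_simps)
    then show "\<gamma> (l + i + j - K) * Re (b i * cnj (b j))
        = 3 * x * (Re (b i * cnj (b j)) / (u i + u j))"
      by simp
  qed
  also have "\<dots> = 3 * x * (\<Sum>i\<in>S. \<Sum>j\<in>S. Re (b i * cnj (b j)) / (u i + u j))"
    by (simp only: sum_distrib_left)
  also have "\<dots> \<ge> 0"
    using x_pos u by (intro mult_nonneg_nonneg cauchy_hermitian_form_nonneg) (auto simp: S_def)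
  finally show ?thesis .
qed

text \<open>Subtracting the square leaves a Cauchy matrix up to diagonal scaling: 1/(M+i+j) -
  M/((M+i)(M+j)) = ij/((M+i)(M+j)(M+i+j)). The factors i/(M+i) and j/(M+j) are absorbed into
  \<open>c\<close>.\<close>

lemma diagonal_form_upper:
  assumes l: "K < l"
  shows "0 \<le> diagonal_form K l b"
proof -
  define M where "M = real (l - K) + 2"
  define u where "u j = real j + M / 2" for j
  define c where "c j = of_real (real j / (M + real j)) * b j" for j
  have M: "0 < M" by (simp add: M_def)
  have "diagonal_form K l b = (\<Sum>i=1..K. \<Sum>j=1..K. 3 * x * (Re (c i * cnj (c j)) / (u i + u j)))"
  proof -
    have "\<gamma> (l + i + j - K) * Re (b i * cnj (b j)) -
        Re (of_real (\<gamma> (l - K + i)) * b i * cnj (of_real (\<gamma> (l - K + j)) * b j)) / \<gamma> (l - K)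
       = 3 * x * (Re (c i * cnj (c j)) / (u i + u j))" for i j
    proof -
      define R where "R = Re (b i * cnj (b j))"
      have g: "\<gamma> (l + i + j - K) = 3 * x / (M + real i + real j)" "\<gamma> (l - K) = 3 * x / M"
        "\<gamma> (l - K + i) = 3 * x / (M + real i)" "\<gamma> (l - K + j) = 3 * x / (M + real j)"
        using l by (simp_all add: \<gamma>_eq M_def of_nat_diff algebra_simps)
      have "Re (of_real r * b i * cnj (of_real s * b j)) = r * s * R" for r s
        by (simp add: R_def algebra_simps)
      then have "\<gamma> (l + i + j - K) * R -
          Re (of_real (\<gamma> (l - K + i)) * b i * cnj (of_real (\<gamma> (l - K + j)) * b j)) / \<gamma> (l - K)
        = 3 * x / (M + real i + real j) * R -
          (3 * x / (M + real i)) * (3 * x / (M + real j)) * R / (3 * x / M)"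
        by (simp only: g)
      also have "\<dots> = 3 * x *
          ((real i / (M + real i)) * (real j / (M + real j)) * R / (M + real i + real j))"
      proof -
        have "M + real i \<noteq> 0" "M + real j \<noteq> 0" "M + real i + real j \<noteq> 0" "M \<noteq> 0" "x \<noteq> 0"
          using M x_pos by linarith+
        then show ?thesis by (simp add: divide_simps) (simp add: algebra_simps)
      qed
      also have "(real i / (M + real i)) * (real j / (M + real j)) * R = Re (c i * cnj (c j))"
        by (simp add: c_def R_def algebra_simps)
      also have "M + real i + real j = u i + u j" by (simp add: u_def)
      finally show ?thesis unfolding R_def .
    qed
    moreover have "(l < K) = False" using l by simp
    ultimately show ?thesis
      by (simp only: diagonal_form_def if_False cmod_sum_sq sum_divide_distrib
          sum_subtractf[symmetric])
  qed
  also have "\<dots> = 3 * x * (\<Sum>i=1..K. \<Sum>j=1..K. Re (c i * cnj (c j)) / (u i + u j))"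
    by (simp only: sum_distrib_left)
  also have "\<dots> \<ge> 0"
    using x_pos M by (intro mult_nonneg_nonneg cauchy_hermitian_form_nonneg) (auto simp: u_def)
  finally show ?thesis .
qed

section \<open>Quantitative bounds for the diagonals -1, 1 and 0\<close>

lemma atLeastAtMost_1_4: "{1..4::nat} = {1,2,3,4}" by auto

lemma diagonal_form_3: "3 * x * ((cmod (b 2))\<^sup>2 / 35280) \<le> diagonal_form 4 3 b"
proof -
  define Q :: "real \<Rightarrow> real \<Rightarrow> real \<Rightarrow> real \<Rightarrow> real" where
    "Q a b c d = a\<^sup>2/3 + b\<^sup>2/5 + c\<^sup>2/7 + d\<^sup>2/9
     + 2 * (a*b/4 + a*c/5 + a*d/6 + b*c/6 + b*d/7 + c*d/8)" for a b c d
  have "diagonal_form 4 3 b = 3 * x * (Q (Re (b 1)) (Re (b 2)) (Re (b 3)) (Re (b 4))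
      + Q (Im (b 1)) (Im (b 2)) (Im (b 3)) (Im (b 4)))"
    unfolding diagonal_form_def atLeastAtMost_1_4 Q_def
    by (simp add: \<gamma>_eq) (simp add: field_simps power2_eq_square)
  moreover have "(cmod (b 2))\<^sup>2 / 35280 \<le> Q (Re (b 1)) (Re (b 2)) (Re (b 3)) (Re (b 4))
      + Q (Im (b 1)) (Im (b 2)) (Im (b 3)) (Im (b 4))"
    unfolding Q_def cmod_power2 add_divide_distrib by (intro add_mono subdiagonal_form_bound)
  ultimately show ?thesis using x_pos by simp
qed

lemma diagonal_form_5: "3 * x * ((cmod (b 1))\<^sup>2 / 250880) \<le> diagonal_form 4 5 b"
proof -
  define Q :: "real \<Rightarrow> real \<Rightarrow> real \<Rightarrow> real \<Rightarrow> real" where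
    "Q a b c d = a\<^sup>2/5 + b\<^sup>2/7 + c\<^sup>2/9 + d\<^sup>2/11
     + 2 * (a*b/6 + a*c/7 + a*d/8 + b*c/8 + b*d/9 + c*d/10) - 3 * (a/4 + b/5 + c/6 + d/7)\<^sup>2"
    for a b c d
  define s where "s = b 1 / 4 + b 2 / 5 + b 3 / 6 + b 4 / 7"
  have "(\<Sum>j=1..4. of_real (\<gamma> (5 - 4 + j)) * b j) = of_real (3 * x) * s"
    unfolding atLeastAtMost_1_4 s_def by (simp add: \<gamma>_eq algebra_simps)
  then have "(cmod (\<Sum>j=1..4. of_real (\<gamma> (5 - 4 + j)) * b j))\<^sup>2 / \<gamma> (5 - 4)
      = 3 * x * (3 * (cmod s)\<^sup>2)"
    using x_pos by (simp add: \<gamma>_eq norm_mult power_mult_distrib power2_eq_square)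
  moreover have "(\<Sum>i=1..4. \<Sum>j=1..4. \<gamma> (5 + i + j - 4) * Re (b i * cnj (b j)))
      - 3 * x * (3 * (cmod s)\<^sup>2)
    = 3 * x * (Q (Re (b 1)) (Re (b 2)) (Re (b 3)) (Re (b 4))
        + Q (Im (b 1)) (Im (b 2)) (Im (b 3)) (Im (b 4)))"
    unfolding atLeastAtMost_1_4 Q_def cmod_power2 s_def
    by (simp add: \<gamma>_eq) (simp add: field_simps power2_eq_square)
  ultimately have "diagonal_form 4 5 b = 3 * x * (Q (Re (b 1)) (Re (b 2)) (Re (b 3)) (Re (b 4))
      + Q (Im (b 1)) (Im (b 2)) (Im (b 3)) (Im (b 4)))"
    by (simp add: diagonal_form_def)
  moreover have "(cmod (b 1))\<^sup>2 / 250880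
      \<le> Q (Re (b 1)) (Re (b 2)) (Re (b 3)) (Re (b 4))
      + Q (Im (b 1)) (Im (b 2)) (Im (b 3)) (Im (b 4))"
    unfolding Q_def cmod_power2 add_divide_distrib by (intro add_mono superdiagonal_form_bound)
  ultimately show ?thesis using x_pos by simp
qed

lemma diagonal_form_4:
  assumes "x \<le> 667 / 990"
  shows "3 * x * (Re (b 1 * cnj (b 2)) * (2 / 94080)) \<le> diagonal_form 4 4 b"
proof -
  define Q :: "real \<Rightarrow> real \<Rightarrow> real \<Rightarrow> real \<Rightarrow> real" where
    "Q a b c d = a\<^sup>2/4 + b\<^sup>2/6 + c\<^sup>2/8 + d\<^sup>2/10
     + 2 * (a*b/5 + a*c/6 + a*d/7 + b*c/7 + b*d/8 + c*d/9) -
     (3 * x) * (a/3 + b/4 + c/5 + d/6)\<^sup>2"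
    for a b c d
  define s where "s = b 1 / 3 + b 2 / 4 + b 3 / 5 + b 4 / 6"
  have "(\<Sum>j=1..4. of_real (\<gamma> (4 - 4 + j)) * b j) = of_real (3 * x) * s"
    unfolding atLeastAtMost_1_4 s_def by (simp add: \<gamma>_eq algebra_simps)
  \<comment> \<open>The divisor \<open>\<gamma> 0\<close> is 1 instead of the value 3x/2 that the
    formula for n > 0 would give, so the square carries the coefficient 3x; it would be 2 in the
    unperturbed case x = 2/3.\<close>
  then have "(cmod (\<Sum>j=1..4. of_real (\<gamma> (4 - 4 + j)) * b j))\<^sup>2 / \<gamma> (4 - 4)
      = 3 * x * ((3 * x) * (cmod s)\<^sup>2)"
    using x_pos by (simp add: \<gamma>_0 norm_mult power_mult_distrib power2_eq_square)
  moreover have "(\<Sum>i=1..4. \<Sum>j=1..4. \<gamma> (4 + i + j - 4) * Re (b i * cnj (b j)))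
      - 3 * x * ((3 * x) * (cmod s)\<^sup>2)
    = 3 * x * (Q (Re (b 1)) (Re (b 2)) (Re (b 3)) (Re (b 4))
        + Q (Im (b 1)) (Im (b 2)) (Im (b 3)) (Im (b 4)))"
    unfolding atLeastAtMost_1_4 Q_def cmod_power2 s_def
    by (simp add: \<gamma>_eq) (simp add: field_simps power2_eq_square)
  ultimately have "diagonal_form 4 4 b = 3 * x * (Q (Re (b 1)) (Re (b 2)) (Re (b 3)) (Re (b 4))
      + Q (Im (b 1)) (Im (b 2)) (Im (b 3)) (Im (b 4)))"
    by (simp add: diagonal_form_def)
  moreover have "Re (b 1 * cnj (b 2)) * (2 / 94080)
      = Re (b 1) * Re (b 2) * (2 / 94080) + Im (b 1) * Im (b 2) * (2 / 94080)"
    by (simp add: algebra_simps)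
  moreover have "\<dots> \<le> Q (Re (b 1)) (Re (b 2)) (Re (b 3)) (Re (b 4))
      + Q (Im (b 1)) (Im (b 2)) (Im (b 3)) (Im (b 4))"
    unfolding Q_def by (intro add_mono main_diagonal_form_bound) (use assms in simp_all)
  ultimately show ?thesis using x_pos by (simp only: mult_le_cancel_left_pos)
qed

section \<open>The sufficient and the necessary bound on \<open>x\<close>\<close>

lemma quartically_hyponormal_shift:
  assumes "x \<le> 667 / 990"
  shows "quartically_hyponormal W"
proof (rule weakly_k_hyponormalI)
  fix c y
  define b where "b l j = cnj (c j) * delayed 4 y (l + j)" for l j
  have sm: "summable (\<lambda>l. diagonal_form 4 l (b l))"
    unfolding b_def using sums_self_commutator_form by (rule sums_summable)
  have nonneg: "0 \<le> diagonal_form 4 l (b l)" if "l \<notin> {3,4,5}" for l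
  proof (cases "l < 4")
    case True
    then show ?thesis by (rule diagonal_form_lower) (simp add: b_def delayed_def)
  next
    case False
    then show ?thesis using that by (intro diagonal_form_upper) auto
  qed
  define p q where "p = cmod (b 3 2)" and "q = cmod (b 5 1)"
  have "\<bar>Re (b 4 1 * cnj (b 4 2))\<bar> \<le> cmod (b 4 1 * cnj (b 4 2))" by (rule abs_Re_le_cmod)
  \<comment> \<open>The only use of the fact that the form is evaluated at a product \<open>cnj (c j) * f n\<close>:
    both sides are the modulus of \<open>c 1 * c 2 * f 1 * f 2\<close>.\<close>
  also have "\<dots> = p * q"
    by (simp add: p_def q_def b_def norm_mult)
  finally have "- (p * q) \<le> Re (b 4 1 * cnj (b 4 2))" by linarith
  \<comment> \<open>Since 35280 and 250880 are 3/8 and 8/3 of 94080, replacing the real part by its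
    lower bound -pq leaves exactly (8p - 3q)^2 / (24 * 94080).\<close>
  then have "0 \<le> p\<^sup>2 / 35280 + Re (b 4 1 * cnj (b 4 2)) * (2 / 94080) + q\<^sup>2 / 250880"
    using zero_le_power2[of "8 * p - 3 * q"] by (simp add: power2_eq_square algebra_simps)
  then have "0 \<le> 3 * x * (p\<^sup>2 / 35280 + Re (b 4 1 * cnj (b 4 2)) * (2 / 94080) + q\<^sup>2 / 250880)"
    using x_pos by simp
  also have "\<dots> \<le> diagonal_form 4 3 (b 3) + diagonal_form 4 4 (b 4) + diagonal_form 4 5 (b 5)"
    unfolding distrib_left p_def q_def
    by (intro add_mono diagonal_form_3 diagonal_form_4 diagonal_form_5 assms)
  also have "\<dots> = (\<Sum>l\<in>{3,4,5}. diagonal_form 4 l (b l))" by simp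
  also have "\<dots> \<le> (\<Sum>l. diagonal_form 4 l (b l))"
    by (rule sum_le_suminf[OF sm]) (use nonneg in auto)
  finally show "0 \<le> (\<Sum>l. diagonal_form 4 l (\<lambda>j. cnj (c j) * delayed 4 y (l + j)))"
    unfolding b_def .
qed

lemma k_hyponormal_3_bound:
  assumes "k_hyponormal 3 W"
  shows "x \<le> 200 / 297"
proof -
  \<comment> \<open>The equality case: \<open>\<Sum>j. c j / (i + j + 2) = 1 / (i + 2)\<close> for \<open>i = 1, 2, 3\<close>.\<close>
  define c :: "nat \<Rightarrow> real" where "c j = (if j = 1 then 6 else if j = 2 then -21/2 else 28/5)" for j
  have set3: "{1..3::nat} = {1,2,3}" by auto
  \<comment> \<open>For this \<open>c\<close>, both the linear sum of c_j/(j+2) and the double sum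
    of c_i c_j/(i+j+2) equal 99/200.\<close>
  have "(3 * x * (99 / 200))\<^sup>2 \<le> 3 * x * (99 / 200)"
    using k_hyponormal_hankel[OF assms, of c] unfolding set3
    by (simp add: \<gamma>_eq c_def)
  then have "3 * x * (99 / 200) \<le> 1"
    using x_pos by (simp add: power2_eq_square)
  then show ?thesis by simp
qed

end

theorem corollary5:
  fixes x :: real
  assumes "x > 0"
  shows "(200 / 297 < x \<and> x \<le> 667 / 990 \<longrightarrow>
            quartically_hyponormal (weighted_shift (weights x)) \<and>
            \<not> k_hyponormal 3 (weighted_shift (weights x))) \<and>
         (k_hyponormal 3 (weighted_shift (weights x)) \<longrightarrow>
            quartically_hyponormal (weighted_shift (weights x)))"
proof -
  interpret perturbed_shift x
    by unfold_locales (simp_all add: bounded_weights weights_pos assms)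
  show ?thesis
    \<comment> \<open>For (ii), 3-hyponormality forces x <= 200/297, which is less than
      667/990.\<close>
    using quartically_hyponormal_shift k_hyponormal_3_bound by fastforce
qed

end
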